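(* Let $F$ be a tract, $n,p\in\mathbb N$, $E=\{1,\dots,n\}$, and $M'$ an $F$-matroid on $E'=E\sqcup\{n+1,\dots,n+p\}$. Fix integers $0\le n_s\le\dots\le n_1\le p$, and for $i=1,\dots,s$ set $J_i=\{n+1,\dots,n+n_i\}$, $I_i=\{n+n_i+1,\dots,n+p\}$ and $M_i=(M'\backslash I_i)/J_i$. Then $(M_1,\dots,M_s)$ is a flag $F$-matroid on $E$.
   Context: A tract is a commutative multiplicative monoid $F$ with identity $1$ and absorbing element $0$ such that $F^\times=F\setminus\{0\}$ is a group, together with a subset $N_F\subseteq\mathbb{N}[F^\times]$ (the nullset) such that $0\in N_F$, $1\notin N_F$, there is a unique $\epsilon\in F^\times$ with $1+\epsilon\in N_F$, and $N_F$ is stable under multiplication by $F^\times$. For a finite totally ordered set $S$, a Grassmann–Plücker function of rank $r$ on $S$ is a map $\varphi:S^r\to F$, not identically zero, alternating (swapping two arguments multiplies the value by $\epsilon$; value $0$ if two arguments coincide), with $\sum_{k=1}^{r+1}\epsilon^k\varphi(y_1,\dots,\widehat{y_k},\dots,y_{r+1})\varphi(y_k,x_1,\dots,x_{r-1})\in N_F$ for all $x_i,y_j\in S$. An $F$-matroid of rank $r$ is a class $M=[\varphi]$ modulo multiplication by $F^\times$; $\underline M$ has as bases the sets $\{x_1,\dots,x_r\}$ with $\varphi(x_1,\dots,x_r)\neq0$. Minors: for $A\subseteq S$, let $\ell$ be the rank of $A$ in $\underline M$ and $\{a_1,\dots,a_\ell\}$ a maximal independent subset of $A$; $M/A$ is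 the $F$-matroid on $S\setminus A$ represented by $(\varphi/A)(x_1,\dots,x_{r-\ell})=\varphi(x_1,\dots,x_{r-\ell},a_1,\dots,a_\ell)$. Let $k$ be the rank of $S\setminus A$ in $\underline M$ and $a_1,\dots,a_{r-k}\in A$ a basis of $\underline M/(S\setminus A)$; $M\backslash A$ is represented on $S\setminus A$ by $(\varphi\backslash A)(x_1,\dots,x_k)=\varphi(x_1,\dots,x_k,a_1,\dots,a_{r-k})$ (well defined up to $F^\times$). If $M=[\mu]$, $N=[\nu]$ have ranks $r,w$ on the same ground set, then $N\twoheadrightarrow M$ means $\sum_{k=1}^{w+1}\epsilon^k\nu(y_1,\dots,\widehat{y_k},\dots,y_{w+1})\mu(y_k,x_1,\dots,x_{r-1})\in N_F$ for all $y_1,\dots,y_{w+1},x_1,\dots,x_{r-1}$. A flag $F$-matroid is a sequence $(M_1,\dots,M_s)$ with $M_j\twoheadrightarrow M_i$ for all $1\le i<j\le s$. *)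

theory Defs
  imports Main "HOL-Library.Multiset" "HOL-Library.FuncSet"
begin

text \<open>The pointed monoid underlying a tract is a whole type; an element of the semiring
  \<open>\<nat>[F\<^sup>\<times>]\<close> is a finite multiset not containing 0, with the empty multiset as zero.\<close>

locale tract =
  fixes NF :: "'f::{comm_monoid_mult, mult_zero, zero_neq_one} multiset set"
  assumes unit_group: "(x::'f) \<noteq> 0 \<Longrightarrow> \<exists>y. x * y = 1"
    and null_units: "X \<in> NF \<Longrightarrow> 0 \<notin># X"
    and null_zero: "{#} \<in> NF"
    and null_one: "{#1#} \<notin> NF"
    and null_eps: "\<exists>!e. e \<noteq> 0 \<and> {#1, e#} \<in> NF"
    and null_scale: "a \<noteq> 0 \<Longrightarrow> X \<in> NF \<Longrightarrow> image_mset ((*) a) X \<in> NF"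

definition eps :: "'f::{comm_monoid_mult, mult_zero, zero_neq_one} multiset set \<Rightarrow> 'f" where
  "eps NF = (THE e. e \<noteq> 0 \<and> {#1, e#} \<in> NF)"

text \<open>Formal sum of a finite family of elements of \<open>F\<close>; the absorbing element 0 of \<open>F\<close> counts as
  the zero of \<open>\<nat>[F\<^sup>\<times>]\<close>, so vanishing terms are dropped.\<close>

definition formal_sum :: "('i \<Rightarrow> 'f::zero) \<Rightarrow> 'i set \<Rightarrow> 'f multiset" where
  "formal_sum f A = filter_mset (\<lambda>x. x \<noteq> 0) (image_mset f (mset_set A))"

definition tuples :: "'s set \<Rightarrow> nat \<Rightarrow> 's list set" where
  "tuples S r = {xs. set xs \<subseteq> S \<and> length xs = r}"

text \<open>Positions are counted from 1, as in \<open>y\<^sub>1, \<dots>, y\<^sub>m\<close>.\<close>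

definition entry :: "'s list \<Rightarrow> nat \<Rightarrow> 's" where
  "entry ys k = ys ! (k - 1)"

definition omit :: "'s list \<Rightarrow> nat \<Rightarrow> 's list" where
  "omit ys k = take (k - 1) ys @ drop k ys"

text \<open>For \<open>r = 0\<close> there are no tuples \<open>x\<^sub>1, \<dots>, x\<^bsub>r-1\<^esub>\<close>, so the condition is void.
  With \<open>\<nu> = \<mu>\<close> these are the Grassmann-Pluecker relations.\<close>

definition pluecker_relations ::
  "'f::{comm_monoid_mult, mult_zero, zero_neq_one} multiset set \<Rightarrow> 's set \<Rightarrow>
    nat \<Rightarrow> ('s list \<Rightarrow> 'f) \<Rightarrow> nat \<Rightarrow> ('s list \<Rightarrow> 'f) \<Rightarrow> bool" where
  "pluecker_relations NF S w \<nu> r \<mu> \<longleftrightarrow>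
    (0 < r \<longrightarrow> (\<forall>ys \<in> tuples S (w + 1). \<forall>xs \<in> tuples S (r - 1).
      formal_sum (\<lambda>k. eps NF ^ k * \<nu> (omit ys k) * \<mu> (entry ys k # xs)) {1..w + 1} \<in> NF))"

definition alternating ::
  "'f::{comm_monoid_mult, mult_zero, zero_neq_one} multiset set \<Rightarrow> 's set \<Rightarrow>
    nat \<Rightarrow> ('s list \<Rightarrow> 'f) \<Rightarrow> bool" where
  "alternating NF S r \<phi> \<longleftrightarrow>
    (\<forall>xs \<in> tuples S r.
      (\<forall>i j. i < j \<and> j < r \<longrightarrow> \<phi> (xs[i := xs ! j, j := xs ! i]) = eps NF * \<phi> xs) \<and>
      (\<not> distinct xs \<longrightarrow> \<phi> xs = 0))"

definition gp_function ::
  "'f::{comm_monoid_mult, mult_zero, zero_neq_one} multiset set \<Rightarrow> 's set \<Rightarrow>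
    nat \<Rightarrow> ('s list \<Rightarrow> 'f) \<Rightarrow> bool" where
  "gp_function NF S r \<phi> \<longleftrightarrow>
    \<phi> \<in> tuples S r \<rightarrow>\<^sub>E UNIV \<and>
    (\<exists>xs \<in> tuples S r. \<phi> xs \<noteq> 0) \<and>
    alternating NF S r \<phi> \<and>
    pluecker_relations NF S r \<phi> r \<phi>"

text \<open>\<open>reps M\<close> is the class \<open>[\<phi>]\<close> itself, as a set of functions.\<close>

datatype ('s, 'f) fmat = FMat (ground: "'s set") (mrank: nat) (reps: "('s list \<Rightarrow> 'f) set")

definition unit_class ::
  "'s set \<Rightarrow> nat \<Rightarrow> ('s list \<Rightarrow> 'f::{times, zero}) \<Rightarrow> ('s list \<Rightarrow> 'f) set" where
  "unit_class S r \<phi> = {restrict (\<lambda>xs. c * \<phi> xs) (tuples S r) | c. c \<noteq> 0}"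

definition F_matroid ::
  "'f::{comm_monoid_mult, mult_zero, zero_neq_one} multiset set \<Rightarrow> ('s, 'f) fmat \<Rightarrow> bool" where
  "F_matroid NF M \<longleftrightarrow>
    finite (ground M) \<and>
    (\<exists>\<phi>. gp_function NF (ground M) (mrank M) \<phi> \<and>
         reps M = unit_class (ground M) (mrank M) \<phi>)"

definition bases :: "('s, 'f::zero) fmat \<Rightarrow> 's set set" where
  "bases M = {set xs | xs. xs \<in> tuples (ground M) (mrank M) \<and> (\<exists>\<phi> \<in> reps M. \<phi> xs \<noteq> 0)}"

text \<open>Ordinary matroids are given by their sets of bases \<open>\<B>\<close>.\<close>

definition indep :: "'s set set \<Rightarrow> 's set \<Rightarrow> bool" where
  "indep \<B> I \<longleftrightarrow> (\<exists>B \<in> \<B>. I \<subseteq> B)"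

definition rank_of :: "'s set set \<Rightarrow> 's set \<Rightarrow> nat" where
  "rank_of \<B> A = Max {card I | I. I \<subseteq> A \<and> indep \<B> I}"

definition max_indep :: "'s set set \<Rightarrow> 's set \<Rightarrow> 's set \<Rightarrow> bool" where
  "max_indep \<B> A I \<longleftrightarrow>
    I \<subseteq> A \<and> indep \<B> I \<and> (\<forall>J. I \<subseteq> J \<and> J \<subseteq> A \<and> indep \<B> J \<longrightarrow> J = I)"

definition contraction_bases :: "'s set set \<Rightarrow> 's set \<Rightarrow> 's set set" where
  "contraction_bases \<B> T = {B. B \<inter> T = {} \<and> (\<exists>I. max_indep \<B> T I \<and> B \<union> I \<in> \<B>)}"

text \<open>The class of a minor collects the functions obtained from every representative \<open>\<phi>\<close> and
  every admissible choice of \<open>a\<^sub>1, a\<^sub>2, \<dots>\<close>. That this is a single class modulo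
  \<open>F\<^sup>\<times>\<close>, i.e. that the minor is well defined, is thus part of its being an \<open>F\<close>-matroid.\<close>

definition contract :: "('s, 'f::zero) fmat \<Rightarrow> 's set \<Rightarrow> ('s, 'f) fmat" where
  "contract M A =
    (let S = ground M - A; m = mrank M - rank_of (bases M) A in
     FMat S m {restrict (\<lambda>xs. \<phi> (xs @ as)) (tuples S m) | \<phi> as.
       \<phi> \<in> reps M \<and> distinct as \<and> max_indep (bases M) A (set as)})"

definition delete :: "('s, 'f::zero) fmat \<Rightarrow> 's set \<Rightarrow> ('s, 'f) fmat" where
  "delete M A =
    (let S = ground M - A; k = rank_of (bases M) S in
     FMat S k {restrict (\<lambda>xs. \<phi> (xs @ as)) (tuples S k) | \<phi> as.
       \<phi> \<in> reps M \<and> distinct as \<and> set as \<in> contraction_bases (bases M) S})"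

text \<open>\<open>quotient NF N M\<close> is the relation with the two-headed arrow from \<open>N\<close> to \<open>M\<close>; by the scaling axiom for the nullset the relations do not depend
  on the representatives.\<close>

definition quotient ::
  "'f::{comm_monoid_mult, mult_zero, zero_neq_one} multiset set \<Rightarrow>
    ('s, 'f) fmat \<Rightarrow> ('s, 'f) fmat \<Rightarrow> bool" where
  "quotient NF N M \<longleftrightarrow>
    ground N = ground M \<and>
    (\<forall>\<nu> \<in> reps N. \<forall>\<mu> \<in> reps M. pluecker_relations NF (ground M) (mrank N) \<nu> (mrank M) \<mu>)"

definition flag_F_matroid ::
  "'f::{comm_monoid_mult, mult_zero, zero_neq_one} multiset set \<Rightarrow> 's set \<Rightarrow>
    nat \<Rightarrow> (nat \<Rightarrow> ('s, 'f) fmat) \<Rightarrow> bool" where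
  "flag_F_matroid NF S s M \<longleftrightarrow>
    (\<forall>i \<in> {1..s}. F_matroid NF (M i) \<and> ground (M i) = S) \<and>
    (\<forall>i j. 1 \<le> i \<and> i < j \<and> j \<le> s \<longrightarrow> quotient NF (M j) (M i))"

end

theory Submission imports Defs begin

text \<open>If \<open>M' = [\<phi>]\<close>, then \<open>M\<^sub>i\<close> is represented by \<open>xs \<mapsto> \<phi> (xs @ a @ b)\<close>, where \<open>a\<close> lists a basis
  of \<open>J\<^sub>i\<close> in \<open>M'\<close> without \<open>I\<^sub>i\<close>, and \<open>b\<close> lists a basis of the contraction of \<open>M'\<close> by the complement
  of \<open>I\<^sub>i\<close>. The relation between \<open>M\<^sub>j\<close> and \<open>M\<^sub>i\<close> for
  \<open>y\<^sub>1, y\<^sub>2, \<dots>\<close> and \<open>x\<^sub>1, x\<^sub>2, \<dots>\<close> consists of terms of the Grassmann-Pluecker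
  relation of \<open>\<phi>\<close> for the tuples extended by \<open>a @ b\<close> of \<open>M\<^sub>j\<close> and of \<open>M\<^sub>i\<close>. All
  other terms vanish: if the moved element lies in \<open>J\<^sub>j\<close>, which is contained in \<open>J\<^sub>i\<close>, the second
  factor has too many arguments in \<open>J\<^sub>i\<close>; if it lies in \<open>I\<^sub>j\<close>, the first factor has
  too many arguments outside \<open>I\<^sub>j\<close>.

  That a minor does not depend on the choice of the added elements reduces by basis exchange to two
  choices that differ in one element, where a single Grassmann-Pluecker relation has only two
  nonzero terms.\<close>

subsection \<open>Formal sums\<close>

lemma formal_sum_cong:
  assumes "finite A" "\<And>k. k \<in> A \<Longrightarrow> f k = g k"
  shows "formal_sum f A = formal_sum g A"
  using assms by (auto simp: formal_sum_def intro!: arg_cong[where f = "filter_mset _"] image_mset_cong)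

lemma formal_sum_mono_neutral:
  assumes "finite A" "B \<subseteq> A" "\<And>k. k \<in> A - B \<Longrightarrow> f k = 0"
  shows "formal_sum f A = formal_sum f B"
proof -
  have "mset_set A = mset_set B + mset_set (A - B)"
    using assms(1,2) by (metis Diff_disjoint Diff_partition finite_Diff infinite_super mset_set_Union)
  moreover have "filter_mset (\<lambda>x. x \<noteq> 0) (image_mset f (mset_set (A - B))) = {#}"
    by (subst set_mset_eq_empty_iff[symmetric]) (use assms in auto)
  ultimately show ?thesis by (simp add: formal_sum_def)
qed

lemma omit_append_Cons [simp]: "omit (us @ y # vs) (Suc (length us)) = us @ vs"
  by (simp add: omit_def)

lemma entry_append_Cons [simp]: "entry (us @ y # vs) (Suc (length us)) = y"
  by (simp add: entry_def)

lemma position_splitE: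
  assumes "k \<in> {1..length ys}"
  obtains us y vs where "ys = us @ y # vs" "k = Suc (length us)"
proof
  show "ys = take (k - 1) ys @ ys ! (k - 1) # drop (Suc (k - 1)) ys"
    using assms by (intro id_take_nth_drop) auto
  show "k = Suc (length (take (k - 1) ys))" using assms by auto
qed

lemma omit_in_tuples:
  assumes "ys \<in> tuples S (w + 1)" "k \<in> {1..w + 1}"
  shows "omit ys k \<in> tuples S w"
  using assms by (auto simp: tuples_def omit_def dest: in_set_takeD in_set_dropD)

lemma entry_in:
  assumes "ys \<in> tuples S (w + 1)" "k \<in> {1..w + 1}"
  shows "entry ys k \<in> S"
  using assms by (auto simp: tuples_def entry_def subset_iff)

text \<open>\<open>B \<inter> A\<close> lies in a basis and is therefore independent, so maximality
  of \<open>I\<close> leaves no room for more.\<close>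

lemma max_indep_eq_inter:
  assumes I: "max_indep \<B> A I" and B: "B \<in> \<B>" "I \<subseteq> B"
  shows "B \<inter> A = I"
proof -
  have "I \<subseteq> B \<inter> A" "indep \<B> (B \<inter> A)" using assms by (auto simp: max_indep_def indep_def)
  then show ?thesis using I by (simp add: max_indep_def)
qed

section \<open>Units and short null sums in a tract\<close>

context tract
begin

lemma mult_left_cancel_unit:
  assumes "a \<noteq> (0::'f)" "a * x = a * y"
  shows "x = y"
proof -
  obtain b where b: "a * b = 1" using unit_group[OF assms(1)] by blast
  have "(a * b) * x = (a * b) * y" using assms(2) by (metis mult.assoc mult.commute)
  then show ?thesis by (simp add: b)
qed

lemma mult_eq_0 [simp]: "a * b = (0::'f) \<longleftrightarrow> a = 0 \<or> b = 0"
  using mult_left_cancel_unit[of a b 0] by auto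

lemma power_eq_0 [simp]: "(a::'f) \<noteq> 0 \<Longrightarrow> a ^ n \<noteq> 0"
  by (induction n) auto

lemma eps_props: "eps NF \<noteq> 0 \<and> {#1, eps NF#} \<in> NF"
  unfolding eps_def by (rule theI') (rule null_eps)

lemma eps_nonzero [simp]: "eps NF \<noteq> 0"
  using eps_props by simp

text \<open>Multiplying by the inverse of \<open>a\<close> would put \<open>{#1#}\<close> into the
  nullset.\<close>

lemma null_singleton: "{#a#} \<in> NF \<Longrightarrow> False"
proof -
  assume a: "{#a#} \<in> NF"
  then have "a \<noteq> 0" using null_units by fastforce
  then obtain b where b: "a * b = 1" using unit_group by blast
  then have "b \<noteq> 0" by auto
  from null_scale[OF this a] show False using b null_one by (simp add: mult.commute)
qed

text \<open>After division by \<open>a\<close> the pair consists of 1 and a unit, and the only such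
  unit is \<open>eps NF\<close>.\<close>

lemma null_pair:
  assumes "{#a, b#} \<in> NF"
  shows "b = eps NF * a"
proof -
  have nz: "a \<noteq> 0" "b \<noteq> 0" using null_units[OF assms] by auto
  then obtain c where c: "a * c = 1" using unit_group by blast
  then have "c \<noteq> 0" by auto
  from null_scale[OF this assms] have "{#1, c * b#} \<in> NF"
    using c by (simp add: mult.commute)
  then have "c * b = eps NF" using eps_props null_eps nz \<open>c \<noteq> 0\<close> by (metis mult_eq_0)
  then show ?thesis using c by (metis mult.assoc mult.commute mult_1)
qed

lemma formal_sum_scale:
  assumes "c \<noteq> (0::'f)" "formal_sum f A \<in> NF"
  shows "formal_sum (\<lambda>k. c * f k) A \<in> NF"
proof -
  have "formal_sum (\<lambda>k. c * f k) A = image_mset ((*) c) (formal_sum f A)"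
    using assms(1) unfolding formal_sum_def
    by (simp add: filter_mset_image_mset image_mset.compositionality comp_def)
  then show ?thesis using null_scale assms by simp
qed

text \<open>Singletons are never null, so a null sum cannot have exactly one nonzero term. Basis
  exchange finds its new element in this way.\<close>

lemma formal_sum_another_nonzero:
  assumes "formal_sum f A \<in> NF" "finite A" "i \<in> A" "f i \<noteq> (0::'f)"
  obtains k where "k \<in> A" "k \<noteq> i" "f k \<noteq> 0"
proof (rule ccontr)
  assume "\<not> thesis"
  then have "formal_sum f A = formal_sum f {i}"
    using that assms by (intro formal_sum_mono_neutral) auto
  then show False using assms null_singleton by (simp add: formal_sum_def)
qed

text \<open>The formal sum shrinks to the terms at \<open>i\<close> and \<open>j\<close>. If one of
  them is 0, so is the other, because singletons are not null; otherwise \<open>null_pair\<close>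
  applies.\<close>

lemma formal_sum_two_terms:
  assumes "formal_sum f A \<in> NF" "finite A" "i \<in> A" "j \<in> A" "i \<noteq> j"
    and "\<And>k. k \<in> A \<Longrightarrow> k \<noteq> i \<Longrightarrow> k \<noteq> j \<Longrightarrow> f k = 0"
  shows "f j = eps NF * (f i::'f)"
proof -
  have "formal_sum f A = formal_sum f {i, j}"
    using assms by (intro formal_sum_mono_neutral) auto
  then have *: "filter_mset (\<lambda>x. x \<noteq> 0) {#f i, f j#} \<in> NF"
    using assms by (simp add: formal_sum_def)
  show ?thesis
  proof (cases "f i = 0")
    case True then show ?thesis using * null_singleton by (auto split: if_splits)
  next
    case False then show ?thesis
      using * null_singleton null_pair by (auto split: if_splits)
  qed
qed

subsection \<open>Alternating functions\<close>

text \<open>The unit \<open>c\<close> is chosen before the prefix \<open>pre\<close>, so reordering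
  the appended arguments multiplies a whole minor by one unit. The induction brings the head of
  \<open>bs\<close> to the front by at most one transposition.\<close>

lemma alternating_permute:
  assumes "alternating NF S r \<phi>" "mset as = mset bs"
  shows "\<exists>c. c \<noteq> 0 \<and> (\<forall>pre. pre @ bs \<in> tuples S r \<longrightarrow> \<phi> (pre @ as) = c * \<phi> (pre @ bs))"
  using assms(2)
proof (induction bs arbitrary: as)
  case Nil then show ?case by (intro exI[of _ 1]) auto
next
  case (Cons b bs)
  then have "b \<in> set as" by (metis list.set_intros(1) mset_eq_setD)
  then obtain us vs where as: "as = us @ b # vs" by (meson split_list)
  show ?case
  proof (cases us)
    case Nil
    then have "mset vs = mset bs" using as Cons.prems by simp
    from Cons.IH[OF this] obtain c where c: "c \<noteq> 0"
      "\<And>pre. pre @ bs \<in> tuples S r \<Longrightarrow> \<phi> (pre @ vs) = c * \<phi> (pre @ bs)" by blast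
    show ?thesis
    proof (intro exI[of _ c] conjI allI impI c(1))
      fix pre assume "pre @ b # bs \<in> tuples S r"
      then show "\<phi> (pre @ as) = c * \<phi> (pre @ b # bs)"
        using c(2)[of "pre @ [b]"] as Nil by simp
    qed
  next
    case (Cons u us')
    \<comment> \<open>Swapping \<open>u\<close> and \<open>b\<close> turns \<open>as\<close> into
      \<open>b # ?cs\<close>, which has the same head as \<open>b # bs\<close>.\<close>
    let ?cs = "us' @ u # vs"
    have m: "mset ?cs = mset bs" using as Cons Cons.prems by simp
    from Cons.IH[OF m] obtain c where c: "c \<noteq> 0"
      "\<And>pre. pre @ bs \<in> tuples S r \<Longrightarrow> \<phi> (pre @ ?cs) = c * \<phi> (pre @ bs)" by blast
    show ?thesis
    proof (intro exI[of _ "eps NF * c"] conjI allI impI)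
      show "eps NF * c \<noteq> 0" using c(1) by simp
      fix pre assume p: "pre @ b # bs \<in> tuples S r"
      let ?xs = "pre @ b # ?cs" and ?i = "length pre" and ?j = "length pre + Suc (length us')"
      have xs: "?xs \<in> tuples S r"
        using p mset_eq_setD[OF m] mset_eq_length[OF m] by (auto simp: tuples_def)
      have "?xs ! ?i = b" by simp
      moreover have "?xs ! ?j = u" by (simp add: nth_append)
      moreover have "?xs[?i := u, ?j := b] = pre @ as"
        using as Cons by (simp add: list_update_append)
      moreover have "?i < ?j" "?j < r" using xs by (auto simp: tuples_def)
      ultimately have "\<phi> (pre @ as) = eps NF * \<phi> ?xs"
        using assms(1) xs unfolding alternating_def by metis
      also have "\<phi> ?xs = c * \<phi> (pre @ b # bs)"
        using c(2)[of "pre @ [b]"] p by simp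
      finally show "\<phi> (pre @ as) = eps NF * c * \<phi> (pre @ b # bs)"
        by (simp add: mult.assoc)
    qed
  qed
qed

lemma alternating_nonzero_cong:
  assumes "alternating NF S r \<phi>" "mset as = mset bs" "bs \<in> tuples S r"
  shows "\<phi> as \<noteq> 0 \<longleftrightarrow> \<phi> bs \<noteq> 0"
  using alternating_permute[OF assms(1,2)] assms(3) by (metis append_Nil mult_eq_0)

lemma alternating_distinct:
  "alternating NF S r \<phi> \<Longrightarrow> xs \<in> tuples S r \<Longrightarrow> \<phi> xs \<noteq> 0 \<Longrightarrow> distinct xs"
  by (auto simp: alternating_def)

subsection \<open>Representatives and bases\<close>

text \<open>Each term contains one value of each function, so the whole sum is multiplied by the
  unit \<open>c * d\<close>, under which the nullset is stable.\<close>

lemma pluecker_relations_scale: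
  assumes "pluecker_relations NF S w \<nu> r \<mu>" "c \<noteq> 0" "d \<noteq> 0"
  shows "pluecker_relations NF S w (restrict (\<lambda>xs. c * \<nu> xs) (tuples S w))
    r (restrict (\<lambda>xs. d * \<mu> xs) (tuples S r))"
  unfolding pluecker_relations_def
proof (intro impI ballI)
  fix ys xs assume r: "0 < r" and ys: "ys \<in> tuples S (w + 1)" and xs: "xs \<in> tuples S (r - 1)"
  let ?f = "\<lambda>k. eps NF ^ k * \<nu> (omit ys k) * \<mu> (entry ys k # xs)"
  have "formal_sum ?f {1..w + 1} \<in> NF" using assms(1) r ys xs by (auto simp: pluecker_relations_def)
  then have "formal_sum (\<lambda>k. (c * d) * ?f k) {1..w + 1} \<in> NF"
    using assms by (intro formal_sum_scale) auto
  also have "formal_sum (\<lambda>k. (c * d) * ?f k) {1..w + 1} = formal_sum (\<lambda>k. eps NF ^ k *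
      restrict (\<lambda>xs. c * \<nu> xs) (tuples S w) (omit ys k) *
      restrict (\<lambda>xs. d * \<mu> xs) (tuples S r) (entry ys k # xs)) {1..w + 1}"
  proof (rule formal_sum_cong)
    fix k assume k: "k \<in> {1..w + 1}"
    have "entry ys k # xs \<in> tuples S r" using entry_in[OF ys k] xs r by (auto simp: tuples_def)
    then show "(c * d) * ?f k = eps NF ^ k *
      restrict (\<lambda>xs. c * \<nu> xs) (tuples S w) (omit ys k) *
      restrict (\<lambda>xs. d * \<mu> xs) (tuples S r) (entry ys k # xs)"
      using omit_in_tuples[OF ys k] by (simp add: mult.assoc mult.left_commute)
  qed simp
  finally show "formal_sum (\<lambda>k. eps NF ^ k *
      restrict (\<lambda>xs. c * \<nu> xs) (tuples S w) (omit ys k) *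
      restrict (\<lambda>xs. d * \<mu> xs) (tuples S r) (entry ys k # xs)) {1..w + 1} \<in> NF" .
qed

lemma swap_in_tuples:
  assumes "xs \<in> tuples S r" "i < r" "j < r"
  shows "xs[i := xs ! j, j := xs ! i] \<in> tuples S r"
proof -
  have "set (xs[i := xs ! j, j := xs ! i]) = set xs"
    using assms by (simp add: tuples_def)
  then show ?thesis using assms by (simp add: tuples_def)
qed

lemma gp_function_scale:
  assumes "gp_function NF S r \<phi>" "c \<noteq> 0"
  shows "gp_function NF S r (restrict (\<lambda>xs. c * \<phi> xs) (tuples S r))"
  unfolding gp_function_def
proof (intro conjI)
  show "\<exists>xs\<in>tuples S r. restrict (\<lambda>xs. c * \<phi> xs) (tuples S r) xs \<noteq> 0"
    using assms by (auto simp: gp_function_def)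
  show "alternating NF S r (restrict (\<lambda>xs. c * \<phi> xs) (tuples S r))"
  proof -
    have "xs[i := xs ! j, j := xs ! i] \<in> tuples S r" if "xs \<in> tuples S r" "i < j" "j < r" for xs i j
      using that swap_in_tuples[of xs S r i j] by simp
    then show ?thesis
      using assms unfolding gp_function_def alternating_def by (auto simp: mult.left_commute)
  qed
  show "pluecker_relations NF S r (restrict (\<lambda>xs. c * \<phi> xs) (tuples S r)) r
     (restrict (\<lambda>xs. c * \<phi> xs) (tuples S r))"
    using assms by (intro pluecker_relations_scale) (auto simp: gp_function_def)
qed auto

lemma F_matroid_reps_scale:
  assumes "F_matroid NF M" "\<phi> \<in> reps M" "c \<noteq> 0"
  shows "restrict (\<lambda>xs. c * \<phi> xs) (tuples (ground M) (mrank M)) \<in> reps M"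
proof -
  obtain \<rho> where \<rho>: "reps M = unit_class (ground M) (mrank M) \<rho>"
    using assms by (auto simp: F_matroid_def)
  then obtain d where "d \<noteq> 0" "\<phi> = restrict (\<lambda>xs. d * \<rho> xs) (tuples (ground M) (mrank M))"
    using assms by (auto simp: unit_class_def)
  then show ?thesis unfolding \<rho> unit_class_def mem_Collect_eq
    using assms(3) by (intro exI[of _ "c * d"]) (auto simp: mult.assoc intro!: restrict_ext)
qed

lemma F_matroid_reps_proportional:
  assumes "F_matroid NF M" "\<phi> \<in> reps M" "\<psi> \<in> reps M"
  obtains c where "c \<noteq> 0" "\<psi> = restrict (\<lambda>xs. c * \<phi> xs) (tuples (ground M) (mrank M))"
proof -
  let ?T = "tuples (ground M) (mrank M)"
  obtain \<rho> where \<rho>: "reps M = unit_class (ground M) (mrank M) \<rho>"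
    using assms by (auto simp: F_matroid_def)
  then obtain d e where d: "d \<noteq> 0" "\<phi> = restrict (\<lambda>xs. d * \<rho> xs) ?T"
    and e: "e \<noteq> 0" "\<psi> = restrict (\<lambda>xs. e * \<rho> xs) ?T"
    using assms by (auto simp: unit_class_def)
  obtain d' where d': "d * d' = 1" using unit_group d by blast
  show thesis
  proof
    show "e * d' \<noteq> 0" using e d' by auto
    have "e * d' * (d * x) = e * x" for x
      using d' by (metis mult.assoc mult.commute mult_1)
    then show "\<psi> = restrict (\<lambda>xs. e * d' * \<phi> xs) ?T"
      using d(2) e(2) by (auto intro!: restrict_ext)
  qed
qed

lemma F_matroid_reps_gp_function:
  assumes "F_matroid NF M" "\<phi> \<in> reps M"
  shows "gp_function NF (ground M) (mrank M) \<phi>"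
  using assms gp_function_scale by (auto simp: F_matroid_def unit_class_def)

lemma F_matroid_reps_alternating:
  "F_matroid NF M \<Longrightarrow> \<phi> \<in> reps M \<Longrightarrow> alternating NF (ground M) (mrank M) \<phi>"
  using F_matroid_reps_gp_function by (auto simp: gp_function_def)

text \<open>The two functions are unit multiples of each other. Both are kept because the two minors
  in a quotient may come from different representatives of the same matroid.\<close>

lemma F_matroid_reps_pluecker:
  assumes "F_matroid NF M" "\<phi> \<in> reps M" "\<psi> \<in> reps M"
  shows "pluecker_relations NF (ground M) (mrank M) \<phi> (mrank M) \<psi>"
proof -
  let ?T = "tuples (ground M) (mrank M)"
  obtain c where c: "c \<noteq> 0" "\<psi> = restrict (\<lambda>xs. c * \<phi> xs) ?T"
    using F_matroid_reps_proportional assms by blast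
  have gp: "gp_function NF (ground M) (mrank M) \<phi>"
    using F_matroid_reps_gp_function assms by blast
  \<comment> \<open>Representatives are extensional, so scaling by 1 and restricting gives back
    \<open>\<phi>\<close> itself.\<close>
  then have "restrict \<phi> ?T = \<phi>"
    by (auto simp: gp_function_def PiE_def extensional_restrict)
  then show ?thesis
    using pluecker_relations_scale[of "ground M" "mrank M" \<phi> "mrank M" \<phi> 1 c] gp c
    by (simp add: gp_function_def)
qed

lemma F_matroid_reps_nonempty:
  assumes "F_matroid NF M"
  obtains \<phi> where "\<phi> \<in> reps M"
proof -
  have "\<exists>c. c \<noteq> (0::'f)" by (intro exI[of _ 1]) simp
  then show thesis using assms that by (force simp: F_matroid_def unit_class_def)
qed

text \<open>\<open>bases\<close> admits any representative and any listing of the set;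
  proportionality of representatives and the alternating property remove both choices.\<close>

lemma reps_nonzero_iff:
  assumes "F_matroid NF M" "\<phi> \<in> reps M" "xs \<in> tuples (ground M) (mrank M)"
  shows "\<phi> xs \<noteq> 0 \<longleftrightarrow> distinct xs \<and> set xs \<in> bases M"
proof
  assume "\<phi> xs \<noteq> 0"
  then show "distinct xs \<and> set xs \<in> bases M"
    using assms F_matroid_reps_alternating alternating_distinct by (fastforce simp: bases_def)
next
  assume d: "distinct xs \<and> set xs \<in> bases M"
  then obtain ys \<psi> where ys: "set xs = set ys" "ys \<in> tuples (ground M) (mrank M)"
    "\<psi> \<in> reps M" "\<psi> ys \<noteq> 0" by (auto simp: bases_def)
  then have "distinct ys" using assms F_matroid_reps_alternating alternating_distinct by blast
  then have "mset xs = mset ys" using d ys by (metis set_eq_iff_mset_eq_distinct)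
  then have "\<psi> xs \<noteq> 0"
    using alternating_nonzero_cong F_matroid_reps_alternating assms ys by blast
  moreover obtain c where "\<psi> = restrict (\<lambda>xs. c * \<phi> xs) (tuples (ground M) (mrank M))"
    using F_matroid_reps_proportional assms ys by blast
  ultimately show "\<phi> xs \<noteq> 0" using assms by auto
qed

lemma bases_ground:
  assumes "F_matroid NF M" "B \<in> bases M"
  shows "B \<subseteq> ground M" "finite B" "card B = mrank M"
proof -
  obtain xs \<phi> where "B = set xs" "xs \<in> tuples (ground M) (mrank M)" "\<phi> \<in> reps M" "\<phi> xs \<noteq> 0"
    using assms by (auto simp: bases_def)
  moreover from this have "distinct xs" using reps_nonzero_iff assms by blast
  ultimately show "B \<subseteq> ground M" "finite B" "card B = mrank M"
    by (auto simp: tuples_def distinct_card)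
qed

lemma bases_nonempty:
  assumes "F_matroid NF M"
  obtains B where "B \<in> bases M"
proof -
  obtain \<phi> where \<phi>: "\<phi> \<in> reps M" using F_matroid_reps_nonempty assms by blast
  with F_matroid_reps_gp_function[OF assms \<phi>] show thesis
    using that by (auto simp: gp_function_def bases_def)
qed

lemma basis_list:
  assumes "F_matroid NF M" "B \<in> bases M" "distinct xs" "set xs = B"
  shows "xs \<in> tuples (ground M) (mrank M)"
  using assms bases_ground[OF assms(1,2)] by (auto simp: tuples_def distinct_card)

text \<open>In the Grassmann-Pluecker relation for \<open>e\<close> followed by a list of
  \<open>B2\<close>, against a list of \<open>B1 - {e}\<close>, the first term is nonzero. Hence
  another term is nonzero, and its two factors exhibit the two new bases.\<close>

lemma basis_exchange:
  assumes F: "F_matroid NF M" and B: "B1 \<in> bases M" "B2 \<in> bases M" and e: "e \<in> B1 - B2"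
  obtains f where "f \<in> B2 - B1" "insert e (B2 - {f}) \<in> bases M" "insert f (B1 - {e}) \<in> bases M"
proof -
  let ?S = "ground M" and ?r = "mrank M"
  obtain \<phi> where \<phi>: "\<phi> \<in> reps M" using F_matroid_reps_nonempty[OF F] by blast
  have fin: "finite B1" "finite B2" using bases_ground[OF F] B by auto
  obtain zs where zs: "distinct zs" "set zs = B2" using finite_distinct_list fin by blast
  obtain xs where xs: "distinct xs" "set xs = B1 - {e}"
    using finite_distinct_list fin by blast
  have exs: "distinct (e # xs)" "set (e # xs) = B1" using xs e by auto
  note tz = basis_list[OF F B(2) zs] and te = basis_list[OF F B(1) exs]
  have "card B1 > 0" using e fin by (auto simp: card_gt_0_iff)
  then have r: "0 < ?r" using bases_ground[OF F B(1)] by simp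
  let ?ys = "e # zs"
  let ?f = "\<lambda>k. eps NF ^ k * \<phi> (omit ?ys k) * \<phi> (entry ?ys k # xs)"
  have ys: "?ys \<in> tuples ?S (?r + 1)" "xs \<in> tuples ?S (?r - 1)"
    using tz te by (auto simp: tuples_def)
  have sum: "formal_sum ?f {1..?r + 1} \<in> NF"
    using F_matroid_reps_pluecker[OF F \<phi> \<phi>] r ys by (auto simp: pluecker_relations_def)
  have nz: "?f 1 \<noteq> 0"
    using reps_nonzero_iff[OF F \<phi> tz] reps_nonzero_iff[OF F \<phi> te] zs exs B
    by (simp add: omit_def entry_def)
  obtain k where k: "k \<in> {1..?r + 1}" "k \<noteq> 1" "?f k \<noteq> 0"
    by (rule formal_sum_another_nonzero[OF sum _ _ nz]) auto
  then have "k \<in> {1..length ?ys}" using tz by (auto simp: tuples_def)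
  then obtain us f vs where us: "?ys = us @ f # vs" "k = Suc (length us)"
    by (rule position_splitE)
  \<comment> \<open>Position 1 holds \<open>e\<close>, so \<open>k \<noteq> 1\<close> places
    \<open>f\<close> in the list of \<open>B2\<close>.\<close>
  then obtain us' where us': "us = e # us'" using k by (cases us) auto
  then have zs': "zs = us' @ f # vs" using us by simp
  have om: "omit ?ys k = e # us' @ vs" and en: "entry ?ys k = f"
    unfolding us(1) us(2) omit_append_Cons entry_append_Cons using us' by simp_all
  have nz: "\<phi> (e # us' @ vs) \<noteq> 0" "\<phi> (f # xs) \<noteq> 0" using k(3) om en by auto
  have "e # us' @ vs \<in> tuples ?S ?r" "f # xs \<in> tuples ?S ?r"
    using ys te by (auto simp: zs' tuples_def)
  with nz have "set (e # us' @ vs) \<in> bases M" "distinct (f # xs)" "set (f # xs) \<in> bases M"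
    using reps_nonzero_iff[OF F \<phi>] by blast+
  moreover have "set (e # us' @ vs) = insert e (B2 - {f})" using zs zs' by auto
  moreover have "f \<in> B2" using zs zs' by auto
  moreover have "set (f # xs) = insert f (B1 - {e})" "f \<notin> B1 - {e}"
    using xs \<open>distinct (f # xs)\<close> by auto
  ultimately show thesis using that[of f] e by auto
qed

subsection \<open>Rank\<close>

text \<open>Exchanges outside \<open>A\<close> move \<open>B2\<close> towards a basis
  \<open>B1\<close> containing \<open>I\<close> without changing \<open>B2 \<inter> A\<close>, until
  \<open>B2\<close> contains \<open>B1 - A\<close> and counting settles the claim.\<close>

lemma basis_inter_card_le_max_indep:
  assumes F: "F_matroid NF M" and I: "max_indep (bases M) A I" and B2: "B2 \<in> bases M"
  shows "card (B2 \<inter> A) \<le> card I"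
proof -
  obtain B1 where B1: "B1 \<in> bases M" "I \<subseteq> B1" using I by (auto simp: max_indep_def indep_def)
  show ?thesis using B2
  proof (induction "card (B2 - B1)" arbitrary: B2 rule: less_induct)
    case less
    note g1 = bases_ground[OF F B1(1)] and g2 = bases_ground[OF F less.prems]
    show ?case
    proof (cases "B1 - A \<subseteq> B2")
      case True
      \<comment> \<open>Bases have equal size, so having no fewer elements outside \<open>A\<close>
        means having no more inside.\<close>
      then have "card (B1 - A) \<le> card (B2 - A)" using g2 by (intro card_mono) auto
      moreover have "card B1 = card (B1 \<inter> A) + card (B1 - A)" "card B2 = card (B2 \<inter> A) + card (B2 - A)"
        using card_Int_Diff[OF g1(2)] card_Int_Diff[OF g2(2)] by blast+
      ultimately show ?thesis using g1 g2 max_indep_eq_inter[OF I B1] by auto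
    next
      case False
      then obtain e where e: "e \<in> B1 - B2" "e \<notin> A" by blast
      obtain f where f: "f \<in> B2 - B1" "insert e (B2 - {f}) \<in> bases M"
        "insert f (B1 - {e}) \<in> bases M"
        using basis_exchange[OF F B1(1) less.prems e(1)] by blast
      have "e \<notin> I" using I e by (auto simp: max_indep_def)
      \<comment> \<open>This basis still contains the maximal set \<open>I\<close>, so the new
        element \<open>f\<close> cannot lie in \<open>A\<close>.\<close>
      then have "insert f (B1 - {e}) \<inter> A = I" using f(3) B1(2) by (intro max_indep_eq_inter[OF I]) auto
      then have "f \<notin> A" using f(1) B1(2) by auto
      then have eq: "insert e (B2 - {f}) \<inter> A = B2 \<inter> A" using e by auto
      have "insert e (B2 - {f}) - B1 \<subset> B2 - B1" using e f by auto
      then have "card (insert e (B2 - {f}) - B1) < card (B2 - B1)"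
        using g2 by (intro psubset_card_mono) auto
      from less.hyps[OF this f(2)] show ?thesis by (simp add: eq)
    qed
  qed
qed

text \<open>The sizes in \<open>rank_of\<close> are bounded by \<open>mrank M\<close> and include
  that of the empty set, so the maximum exists. A basis containing an optimal independent set gives
  the first claim.\<close>

lemma rank_of_attained:
  assumes F: "F_matroid NF M"
  shows "\<exists>B \<in> bases M. card (B \<inter> A) = rank_of (bases M) A"
    and "B \<in> bases M \<Longrightarrow> card (B \<inter> A) \<le> rank_of (bases M) A"
    and "indep (bases M) I \<Longrightarrow> I \<subseteq> A \<Longrightarrow> card I \<le> rank_of (bases M) A"
proof -
  let ?C = "{card I | I. I \<subseteq> A \<and> indep (bases M) I}"
  have "?C \<subseteq> {..mrank M}"
    using bases_ground[OF F] by (auto simp: indep_def) (metis card_mono)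
  then have fin: "finite ?C" by (rule finite_subset) simp
  obtain B0 where "B0 \<in> bases M" using bases_nonempty[OF F] by blast
  then have ne: "?C \<noteq> {}" by (auto simp: indep_def)
  show le: "card I \<le> rank_of (bases M) A" if "indep (bases M) I" "I \<subseteq> A" for I
    unfolding rank_of_def using fin that by (intro Max_ge) auto
  show le': "card (B \<inter> A) \<le> rank_of (bases M) A" if "B \<in> bases M" for B
    using that by (intro le) (auto simp: indep_def)
  have "rank_of (bases M) A \<in> ?C" unfolding rank_of_def using fin ne by (rule Max_in)
  then obtain I B where I: "rank_of (bases M) A = card I" "I \<subseteq> A" "B \<in> bases M" "I \<subseteq> B"
    by (auto simp: indep_def)
  have "card I \<le> card (B \<inter> A)" using I bases_ground[OF F] by (intro card_mono) auto
  then show "\<exists>B \<in> bases M. card (B \<inter> A) = rank_of (bases M) A" using I le' by (metis le_antisym)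
qed

text \<open>All maximal independent subsets of \<open>A\<close> have the same size by
  \<open>basis_inter_card_le_max_indep\<close>, and a set of the size of the rank cannot be
  enlarged. In this form the sets appended in a contraction become traces of bases.\<close>

lemma max_indep_iff:
  assumes F: "F_matroid NF M"
  shows "max_indep (bases M) A I \<longleftrightarrow> (\<exists>B \<in> bases M. B \<inter> A = I \<and> card I = rank_of (bases M) A)"
proof
  assume I: "max_indep (bases M) A I"
  then obtain B where B: "B \<in> bases M" "I \<subseteq> B" by (auto simp: max_indep_def indep_def)
  then have "B \<inter> A = I" by (rule max_indep_eq_inter[OF I])
  moreover have "rank_of (bases M) A \<le> card I"
    using rank_of_attained(1)[OF F] basis_inter_card_le_max_indep[OF F I] by metis
  ultimately show "\<exists>B \<in> bases M. B \<inter> A = I \<and> card I = rank_of (bases M) A"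
    using B rank_of_attained(2)[OF F B(1)] by (metis le_antisym)
next
  assume "\<exists>B \<in> bases M. B \<inter> A = I \<and> card I = rank_of (bases M) A"
  then obtain B where B: "B \<in> bases M" "B \<inter> A = I" "card I = rank_of (bases M) A" by blast
  have "J = I" if J: "I \<subseteq> J" "J \<subseteq> A" "indep (bases M) J" for J
  proof -
    have "finite J" using J bases_ground[OF F] by (auto simp: indep_def intro: finite_subset)
    then show ?thesis using J B rank_of_attained(3)[OF F J(3,2)] by (metis card_seteq)
  qed
  then show "max_indep (bases M) A I" using B by (auto simp: max_indep_def indep_def)
qed

subsection \<open>Minors\<close>

text \<open>For suitable \<open>l\<close>, these are the sets that may be appended when
  \<open>A\<close> is contracted or deleted.\<close>

definition basis_traces :: "'s set set \<Rightarrow> 's set \<Rightarrow> nat \<Rightarrow> 's set set" where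
  "basis_traces \<B> A l = {B \<inter> A | B. B \<in> \<B> \<and> card (B \<inter> A) = l}"

text \<open>The extreme values \<open>l\<close> are the rank of \<open>A\<close>, which gives \<open>M/A\<close>, and the rank of \<open>M\<close> minus that of the
  complement of \<open>A\<close>, which gives \<open>M\<close> without \<open>A\<close>; this lets both minors be treated at once.\<close>

definition extreme_trace_size :: "'s set set \<Rightarrow> 's set \<Rightarrow> nat \<Rightarrow> bool" where
  "extreme_trace_size \<B> A l \<longleftrightarrow>
    (\<forall>B \<in> \<B>. card (B \<inter> A) \<le> l) \<or> (\<forall>B \<in> \<B>. l \<le> card (B \<inter> A))"

lemma basis_tracesI:
  "B \<in> \<B> \<Longrightarrow> B \<inter> A = C \<Longrightarrow> card C = l \<Longrightarrow> C \<in> basis_traces \<B> A l"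
  by (auto simp: basis_traces_def)

text \<open>A basis exchange with \<open>e\<close> in \<open>A\<close> gives two new bases. If
  \<open>f\<close> were outside \<open>A\<close>, one of them would meet \<open>A\<close> in
  \<open>l + 1\<close> elements and the other in \<open>l - 1\<close>, against either form of
  extremality.\<close>

lemma basis_traces_exchange:
  assumes F: "F_matroid NF M" and ext: "extreme_trace_size (bases M) A l"
    and C: "C \<in> basis_traces (bases M) A l" "C' \<in> basis_traces (bases M) A l" "C \<noteq> C'"
  obtains e f where "e \<in> C' - C" "f \<in> C - C'" "insert e (C - {f}) \<in> basis_traces (bases M) A l"
proof -
  obtain B where B: "B \<in> bases M" "B \<inter> A = C" "card C = l"
    using C(1) by (auto simp: basis_traces_def)
  obtain B' where B': "B' \<in> bases M" "B' \<inter> A = C'" "card C' = l"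
    using C(2) by (auto simp: basis_traces_def)
  have fC: "finite C" "finite C'"
    using bases_ground(2)[OF F B(1)] bases_ground(2)[OF F B'(1)] B(2) B'(2) by blast+
  then have "\<not> C' \<subseteq> C" using card_subset_eq[OF fC(1), of C'] B(3) B'(3) C(3) by auto
  then obtain e where e: "e \<in> C' - C" by blast
  then have "e \<in> B' - B" using B(2) B'(2) by blast
  then obtain f where f: "f \<in> B - B'" "insert e (B - {f}) \<in> bases M" "insert f (B' - {e}) \<in> bases M"
    using basis_exchange[OF F B'(1) B(1)] by blast
  have eA: "e \<in> A" "e \<notin> C" "e \<in> C'" using e B'(2) by blast+
  have "f \<in> A"
  proof (rule ccontr)
    assume "f \<notin> A"
    then have "insert e (B - {f}) \<inter> A = insert e C" "insert f (B' - {e}) \<inter> A = C' - {e}"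
      using B(2) B'(2) eA by blast+
    moreover have "card (insert e C) = Suc l" using fC eA(2) B(3) by simp
    moreover have "card (C' - {e}) < l" using card_Diff1_less[OF fC(2) eA(3)] B'(3) by simp
    ultimately have "l < card (insert e (B - {f}) \<inter> A)" "card (insert f (B' - {e}) \<inter> A) < l"
      by simp_all
    then show False using ext f(2,3) unfolding extreme_trace_size_def by (meson not_less)
  qed
  then have fC': "f \<in> C - C'" using f(1) B(2) B'(2) by blast
  have "insert e (B - {f}) \<inter> A = insert e (C - {f})" using B(2) eA(1) by blast
  from f(2) this have "insert e (C - {f}) \<in> basis_traces (bases M) A l"
  proof (rule basis_tracesI)
    show "card (insert e (C - {f})) = l"
      using card_Suc_Diff1[OF fC(1), of f] fC(1) fC' eA(2) B(3) by simp
  qed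
  with e fC' show thesis by (rule that)
qed

section \<open>Independence of a minor from the added elements\<close>

context
  fixes M :: "('s, 'f) fmat" and A :: "'s set" and l m :: nat and \<phi> :: "'s list \<Rightarrow> 'f"
  assumes F: "F_matroid NF M" and \<phi>: "\<phi> \<in> reps M"
    and lm: "m + l = mrank M"
    and ext: "extreme_trace_size (bases M) A l"
begin

lemma basis_traces_nonzero:
  assumes "distinct as" "set as \<in> basis_traces (bases M) A l"
  obtains xs where "xs \<in> tuples (ground M - A) m" "\<phi> (xs @ as) \<noteq> 0"
proof -
  obtain B where B: "B \<in> bases M" "B \<inter> A = set as" "card (set as) = l"
    using assms by (auto simp: basis_traces_def)
  note g = bases_ground[OF F B(1)]
  obtain xs where xs: "distinct xs" "set xs = B - A" using finite_distinct_list g by blast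
  have d: "distinct (xs @ as)" "set (xs @ as) = B" using assms xs B by auto
  note t = basis_list[OF F B(1) d]
  have "length as = l" using B assms by (simp add: distinct_card)
  then have "xs \<in> tuples (ground M - A) m" using t xs g lm by (auto simp: tuples_def)
  moreover have "\<phi> (xs @ as) \<noteq> 0" using reps_nonzero_iff[OF F \<phi> t] d B by blast
  ultimately show thesis using that by blast
qed

lemma basis_traces_list:
  assumes "distinct as" "set as \<in> basis_traces (bases M) A l"
  shows "set as \<subseteq> A \<inter> ground M" "length as = l"
  using assms bases_ground(1)[OF F] distinct_card[of as] by (auto simp: basis_traces_def)

lemma append_in_tuples:
  assumes "xs \<in> tuples (ground M - A) m" "set as \<subseteq> ground M" "length as = l"
  shows "xs @ as \<in> tuples (ground M) (mrank M)"
  using assms lm by (auto simp: tuples_def)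

text \<open>The ratio is read off the Grassmann-Pluecker relation for \<open>xs @ a' # a # c\<close>
  against \<open>zs @ c\<close>, where only the terms that move \<open>a'\<close> or
  \<open>a\<close> survive.\<close>

lemma minor_proportional_step:
  assumes a: "distinct (a # c)" "set (a # c) \<in> basis_traces (bases M) A l"
    and a': "distinct (a' # c)" "set (a' # c) \<in> basis_traces (bases M) A l"
    and ne: "a \<noteq> a'"
  shows "\<exists>d. d \<noteq> 0 \<and> (\<forall>xs \<in> tuples (ground M - A) m. \<phi> (xs @ a' # c) = d * \<phi> (xs @ a # c))"
proof -
  let ?S = "ground M" and ?r = "mrank M"
  note la = basis_traces_list[OF a] and la' = basis_traces_list[OF a']
  obtain zs where zs: "zs \<in> tuples (?S - A) m" "\<phi> (zs @ a # c) \<noteq> 0"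
    using basis_traces_nonzero[OF a] by blast
  \<comment> \<open>Neither value involves \<open>xs\<close>, so their ratio is uniform in
    \<open>xs\<close>.\<close>
  define p q where "p = \<phi> (a # zs @ c)" and "q = \<phi> (a' # zs @ c)"
  have alt: "alternating NF ?S ?r \<phi>" using F \<phi> by (rule F_matroid_reps_alternating)
  have zc: "zs @ a # c \<in> tuples ?S ?r" using zs la by (intro append_in_tuples) auto
  have "p \<noteq> 0" unfolding p_def
    using alternating_nonzero_cong[OF alt _ zc, of "a # zs @ c"] zs by simp
  have key: "\<phi> (xs @ a' # c) * p = \<phi> (xs @ a # c) * q" if xs: "xs \<in> tuples (?S - A) m" for xs
  proof -
    let ?ys = "xs @ a' # a # c"
    let ?f = "\<lambda>k. eps NF ^ k * \<phi> (omit ?ys k) * \<phi> (entry ?ys k # zs @ c)"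
    have lx: "length xs = m" using xs by (simp add: tuples_def)
    have ys: "?ys \<in> tuples ?S (?r + 1)" using xs la la' lm by (auto simp: tuples_def)
    have zs': "zs @ c \<in> tuples ?S (?r - 1)" using zs la lm by (auto simp: tuples_def)
    have r: "0 < ?r" using la lm by auto
    have sum: "formal_sum ?f {1..?r + 1} \<in> NF"
      using F_matroid_reps_pluecker[OF F \<phi> \<phi>] r ys zs' by (auto simp: pluecker_relations_def)
    have cons: "y # zs @ c \<in> tuples ?S ?r" if "y \<in> ?S" for y
      using that zs' r by (auto simp: tuples_def)
    have "?f (m + 2) = eps NF * ?f (m + 1)"
    proof (rule formal_sum_two_terms[OF sum])
      show "m + 1 \<in> {1..?r + 1}" "m + 2 \<in> {1..?r + 1}" using la lm by auto
      fix k assume k: "k \<in> {1..?r + 1}" "k \<noteq> m + 1" "k \<noteq> m + 2"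
      show "?f k = 0"
      proof (cases "k \<le> m")
        case True
        then have "k \<in> {1..length xs}" using k lx by auto
        then obtain us y vs where us: "xs = us @ y # vs" "k = Suc (length us)"
          by (rule position_splitE)
        have om: "omit ?ys k = us @ vs @ a' # a # c" and en: "entry ?ys k = y"
          unfolding us by simp_all
        have "us @ vs @ a' # a # c \<in> tuples ?S ?r" "y # zs @ c \<in> tuples ?S ?r"
          using ys cons by (auto simp: us tuples_def)
        then have nz: "\<phi> (us @ vs @ a' # a # c) \<noteq> 0 \<Longrightarrow> set (us @ vs @ a' # a # c) \<in> bases M"
          "\<phi> (y # zs @ c) \<noteq> 0 \<Longrightarrow> set (y # zs @ c) \<in> bases M"
          using reps_nonzero_iff[OF F \<phi>] by blast+
        \<comment> \<open>The factors would give bases with \<open>l + 1\<close> and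
          \<open>l - 1\<close> elements in \<open>A\<close>, which cannot both exist when
          \<open>l\<close> is extreme.\<close>
        have "set (us @ vs @ a' # a # c) \<inter> A = set (a' # a # c)" "set (y # zs @ c) \<inter> A = set c"
          using xs zs la la' by (auto simp: us tuples_def)
        moreover have "card (set (a' # a # c)) = Suc l" "Suc (card (set c)) = l"
          using a a' ne la by (auto simp: distinct_card)
        ultimately have "\<phi> (us @ vs @ a' # a # c) = 0 \<or> \<phi> (y # zs @ c) = 0"
          using ext nz unfolding extreme_trace_size_def by (metis Suc_n_not_le_n)
        then show ?thesis using om en by auto
      next
        case False
        \<comment> \<open>Beyond position \<open>m + 2\<close> the moved element comes from
          \<open>c\<close>, hence it occurs twice in the second factor.\<close>
        then have "k - (m + 2) \<in> {1..length c}" using k la lm by auto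
        then obtain us y vs where us: "c = us @ y # vs" "k - (m + 2) = Suc (length us)"
          by (rule position_splitE)
        then have "?ys = (xs @ a' # a # us) @ y # vs" "k = Suc (length (xs @ a' # a # us))"
          using lx by auto
        then have en: "entry ?ys k = y" by (metis entry_append_Cons)
        have "y \<in> ?S" "\<not> distinct (y # zs @ c)" using la us by auto
        then have "\<phi> (y # zs @ c) = 0" using alternating_distinct[OF alt cons] by blast
        then show ?thesis by (simp add: en)
      qed
    qed auto
    moreover have "omit ?ys (m + 1) = xs @ a # c" "entry ?ys (m + 1) = a'"
      unfolding lx[symmetric] by simp_all
    moreover have "omit ?ys (m + 2) = xs @ a' # c" "entry ?ys (m + 2) = a"
      using omit_append_Cons[of "xs @ [a']" a c] entry_append_Cons[of "xs @ [a']" a c]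
      by (simp_all add: lx)
    \<comment> \<open>The \<open>eps NF\<close> of the two-term sum raises the lower exponent, so
      both sides carry the same power and the sign cancels.\<close>
    ultimately have "eps NF ^ (m + 2) * (\<phi> (xs @ a' # c) * p) = eps NF ^ (m + 2) * (\<phi> (xs @ a # c) * q)"
      by (simp add: p_def q_def mult.assoc)
    then show ?thesis by (rule mult_left_cancel_unit[rotated]) simp
  qed
  obtain p' where p': "p * p' = 1" using unit_group \<open>p \<noteq> 0\<close> by blast
  have eq: "\<phi> (xs @ a' # c) = (q * p') * \<phi> (xs @ a # c)" if "xs \<in> tuples (?S - A) m" for xs
  proof -
    have "\<phi> (xs @ a' # c) = \<phi> (xs @ a' # c) * p * p'" by (simp add: mult.assoc p')
    then show ?thesis unfolding key[OF that] by (metis mult.assoc mult.commute)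
  qed
  \<comment> \<open>A nonzero value of the minor for \<open>a' # c\<close> rules out the ratio
    0.\<close>
  obtain xs where "xs \<in> tuples (?S - A) m" "\<phi> (xs @ a' # c) \<noteq> 0"
    using basis_traces_nonzero[OF a'] by blast
  then have "q * p' \<noteq> 0" using eq by force
  then show ?thesis using eq by blast
qed

text \<open>Exchange steps lead from \<open>as\<close> to \<open>bs\<close>, each bringing in one
  more element of \<open>bs\<close>; their constants multiply, together with those from
  reordering.\<close>

lemma minor_proportional:
  assumes "distinct as" "set as \<in> basis_traces (bases M) A l"
    and "distinct bs" "set bs \<in> basis_traces (bases M) A l"
  shows "\<exists>d. d \<noteq> 0 \<and> (\<forall>xs \<in> tuples (ground M - A) m. \<phi> (xs @ bs) = d * \<phi> (xs @ as))"
  using assms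
proof (induction "card (set bs - set as)" arbitrary: as rule: less_induct)
  case less
  let ?T = "tuples (ground M - A) m"
  have alt: "alternating NF (ground M) (mrank M) \<phi>" using F \<phi> by (rule F_matroid_reps_alternating)
  have perm: "\<exists>d. d \<noteq> 0 \<and> (\<forall>xs \<in> ?T. \<phi> (xs @ cs) = d * \<phi> (xs @ as))"
    if "distinct cs" "set cs = set as" for cs
  proof -
    have "mset cs = mset as" using that less.prems by (metis set_eq_iff_mset_eq_distinct)
    from alternating_permute[OF alt this] show ?thesis
      using append_in_tuples basis_traces_list[OF less.prems(1,2)] by (metis le_inf_iff)
  qed
  show ?case
  proof (cases "set as = set bs")
    case True then show ?thesis using perm less.prems by metis
  next
    case False
    then obtain e f where ef: "e \<in> set bs - set as" "f \<in> set as - set bs"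
      "insert e (set as - {f}) \<in> basis_traces (bases M) A l"
      using basis_traces_exchange[OF F ext less.prems(2,4)] by blast
    obtain c where c: "distinct c" "set c = set as - {f}"
      using finite_distinct_list[of "set as - {f}"] by auto
    \<comment> \<open>The exchanged element is listed first, as
      \<open>minor_proportional_step\<close> requires; \<open>d1\<close> accounts for this
      reordering.\<close>
    have f: "distinct (f # c)" "set (f # c) = set as" using c ef by auto
    have e: "distinct (e # c)" "set (e # c) \<in> basis_traces (bases M) A l" using c ef by auto
    obtain d1 where d1: "d1 \<noteq> 0" "\<And>xs. xs \<in> ?T \<Longrightarrow> \<phi> (xs @ f # c) = d1 * \<phi> (xs @ as)"
      using perm[OF f] by blast
    obtain d2 where d2: "d2 \<noteq> 0" "\<And>xs. xs \<in> ?T \<Longrightarrow> \<phi> (xs @ e # c) = d2 * \<phi> (xs @ f # c)"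
      using minor_proportional_step[of f c e] f e ef less.prems(2) by auto
    have "set bs - set (e # c) \<subset> set bs - set as" using c ef by auto
    then have "card (set bs - set (e # c)) < card (set bs - set as)"
      by (intro psubset_card_mono) auto
    from less.hyps[OF this e less.prems(3,4)]
    obtain d3 where d3: "d3 \<noteq> 0" "\<And>xs. xs \<in> ?T \<Longrightarrow> \<phi> (xs @ bs) = d3 * \<phi> (xs @ e # c)" by blast
    show ?thesis
      using d1 d2 d3 by (intro exI[of _ "d3 * (d2 * d1)"]) (simp add: mult.assoc)
  qed
qed

end

text \<open>No signs appear: the added arguments stand last, so the positions of \<open>y\<^sub>1, y\<^sub>2, \<dots>\<close> are
  the same in both relations.\<close>

lemma pluecker_relations_append:
  assumes P: "pluecker_relations NF S r \<phi> r \<psi>" and S: "T \<subseteq> S" "set b \<subseteq> S" "set a \<subseteq> S"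
    and len: "w + length b = r" "v + length a = r"
    and vanish: "\<And>us y vs ys xs. b = us @ y # vs \<Longrightarrow> 0 < v \<Longrightarrow> ys \<in> tuples T (w + 1) \<Longrightarrow>
      xs \<in> tuples T (v - 1) \<Longrightarrow> \<phi> (ys @ us @ vs) = 0 \<or> \<psi> (y # xs @ a) = 0"
  shows "pluecker_relations NF T w (restrict (\<lambda>xs. \<phi> (xs @ b)) (tuples T w))
    v (restrict (\<lambda>xs. \<psi> (xs @ a)) (tuples T v))"
  unfolding pluecker_relations_def
proof (intro impI ballI)
  fix ys xs assume v: "0 < v" and ys: "ys \<in> tuples T (w + 1)" and xs: "xs \<in> tuples T (v - 1)"
  let ?f = "\<lambda>k. eps NF ^ k * \<phi> (omit (ys @ b) k) * \<psi> (entry (ys @ b) k # xs @ a)"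
  let ?g = "\<lambda>k. eps NF ^ k * restrict (\<lambda>xs. \<phi> (xs @ b)) (tuples T w) (omit ys k) *
    restrict (\<lambda>xs. \<psi> (xs @ a)) (tuples T v) (entry ys k # xs)"
  have ly: "length ys = w + 1" using ys by (simp add: tuples_def)
  have "ys @ b \<in> tuples S (r + 1)" "xs @ a \<in> tuples S (r - 1)" "0 < r"
    using ys xs S len v by (auto simp: tuples_def)
  then have "formal_sum ?f {1..r + 1} \<in> NF" using P by (auto simp: pluecker_relations_def)
  \<comment> \<open>The terms beyond \<open>w + 1\<close> move an element of \<open>b\<close> and
    vanish by assumption.\<close>
  also have "formal_sum ?f {1..r + 1} = formal_sum ?f {1..w + 1}"
  proof (rule formal_sum_mono_neutral)
    show "{1..w + 1} \<subseteq> {1..r + 1}" using len by auto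
    fix k assume k: "k \<in> {1..r + 1} - {1..w + 1}"
    then have "k - (w + 1) \<in> {1..length b}" using len by auto
    then obtain us y vs where us: "b = us @ y # vs" "k - (w + 1) = Suc (length us)"
      by (rule position_splitE)
    have "ys @ b = (ys @ us) @ y # vs" "k = Suc (length (ys @ us))" using us ly k by auto
    then have "omit (ys @ b) k = ys @ us @ vs" "entry (ys @ b) k = y"
      by (metis omit_append_Cons append_assoc, metis entry_append_Cons)
    then show "?f k = 0" using vanish[OF us(1) v ys xs] by auto
  qed simp
  also have "\<dots> = formal_sum ?g {1..w + 1}"
  proof (rule formal_sum_cong)
    fix k assume k: "k \<in> {1..w + 1}"
    then have "k \<in> {1..length ys}" using ly by simp
    then obtain us y vs where us: "ys = us @ y # vs" "k = Suc (length us)"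
      by (rule position_splitE)
    have "omit (ys @ b) k = omit ys k @ b" "entry (ys @ b) k = entry ys k" unfolding us by simp_all
    moreover have "entry ys k # xs \<in> tuples T v"
      using entry_in[OF ys k] xs v by (auto simp: tuples_def)
    ultimately show "?f k = ?g k" using omit_in_tuples[OF ys k] by simp
  qed simp
  finally show "formal_sum ?g {1..w + 1} \<in> NF" .
qed

text \<open>One representative with one list \<open>as\<close> already gives a Grassmann-Pluecker
  function. By \<open>minor_proportional\<close> all other choices give unit multiples of it, and
  scaling the representative reaches every multiple.\<close>

lemma minor_F_matroid:
  assumes F: "F_matroid NF M" and lm: "m + l = mrank M"
    and ext: "extreme_trace_size (bases M) A l" and ne: "\<exists>B \<in> bases M. card (B \<inter> A) = l"
  shows "F_matroid NF (FMat (ground M - A) m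
    {restrict (\<lambda>xs. \<phi> (xs @ as)) (tuples (ground M - A) m) | \<phi> as.
      \<phi> \<in> reps M \<and> distinct as \<and> set as \<in> basis_traces (bases M) A l})"
    (is "F_matroid NF (FMat ?T m ?R)")
proof -
  let ?t = "tuples ?T m"
  obtain \<phi> where \<phi>: "\<phi> \<in> reps M" using F_matroid_reps_nonempty[OF F] by blast
  obtain B where B: "B \<in> bases M" "card (B \<inter> A) = l" using ne by blast
  obtain as where as: "distinct as" "set as = B \<inter> A"
    using finite_distinct_list[of "B \<inter> A"] bases_ground[OF F B(1)] by auto
  then have tr: "set as \<in> basis_traces (bases M) A l" using B by (intro basis_tracesI[OF B(1)]) auto
  define \<rho> where "\<rho> = restrict (\<lambda>xs. \<phi> (xs @ as)) ?t"
  have alt: "alternating NF (ground M) (mrank M) \<phi>" using F \<phi> by (rule F_matroid_reps_alternating)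
  note la = basis_traces_list[OF F \<phi> lm ext as(1) tr]
  have app: "xs @ as \<in> tuples (ground M) (mrank M)" if "xs \<in> ?t" for xs
    using append_in_tuples[OF F \<phi> lm ext that] la by auto
  have "gp_function NF ?T m \<rho>"
    unfolding gp_function_def
  proof (intro conjI)
    show "\<rho> \<in> ?t \<rightarrow>\<^sub>E UNIV" by (simp add: \<rho>_def)
    show "\<exists>xs \<in> ?t. \<rho> xs \<noteq> 0"
      using basis_traces_nonzero[OF F \<phi> lm ext as(1) tr] by (metis \<rho>_def restrict_apply')
    show "alternating NF ?T m \<rho>"
      unfolding alternating_def
    proof (intro ballI conjI allI impI)
      fix xs assume xs: "xs \<in> ?t"
      show "\<rho> xs = 0" if "\<not> distinct xs"
        using alternating_distinct[OF alt app[OF xs]] that xs by (auto simp: \<rho>_def)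
      fix i j assume ij: "i < j \<and> j < m"
      have lx: "length xs = m" using xs by (simp add: tuples_def)
      have "(xs @ as)[i := (xs @ as) ! j, j := (xs @ as) ! i] = xs[i := xs ! j, j := xs ! i] @ as"
        using ij lx by (simp add: nth_append list_update_append)
      moreover have "i < j \<and> j < mrank M" using ij lm by auto
      ultimately have "\<phi> (xs[i := xs ! j, j := xs ! i] @ as) = eps NF * \<phi> (xs @ as)"
        using alt app[OF xs] unfolding alternating_def by metis
      moreover have "xs[i := xs ! j, j := xs ! i] \<in> ?t" using swap_in_tuples[OF xs] ij by auto
      ultimately show "\<rho> (xs[i := xs ! j, j := xs ! i]) = eps NF * \<rho> xs"
        using xs by (simp add: \<rho>_def)
    qed
    show "pluecker_relations NF ?T m \<rho> m \<rho>"
      unfolding \<rho>_def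
    proof (rule pluecker_relations_append[OF F_matroid_reps_pluecker[OF F \<phi> \<phi>]])
      fix us y vs ys xs
      assume u: "as = us @ y # vs" and "0 < m" and "xs \<in> tuples ?T (m - 1)"
      \<comment> \<open>The moved element \<open>y\<close> is still present in the \<open>as\<close>
        of the second factor, which therefore has a repeated argument.\<close>
      then have "y # xs @ as \<in> tuples (ground M) (mrank M)"
        using la lm by (auto simp: tuples_def)
      moreover have "\<not> distinct (y # xs @ as)" using u by simp
      ultimately have "\<phi> (y # xs @ as) = 0" using alternating_distinct[OF alt] by blast
      then show "\<phi> (ys @ us @ vs) = 0 \<or> \<phi> (y # xs @ as) = 0" by simp
    qed (use la lm in auto)
  qed
  moreover have "?R = unit_class ?T m \<rho>"
  proof (intro equalityI subsetI)
    fix \<theta> assume "\<theta> \<in> ?R"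
    then obtain \<psi> bs where \<theta>: "\<theta> = restrict (\<lambda>xs. \<psi> (xs @ bs)) ?t" "\<psi> \<in> reps M" "distinct bs"
      "set bs \<in> basis_traces (bases M) A l" by blast
    obtain c where c: "c \<noteq> 0" "\<psi> = restrict (\<lambda>xs. c * \<phi> xs) (tuples (ground M) (mrank M))"
      using F_matroid_reps_proportional[OF F \<phi> \<theta>(2)] by blast
    obtain d where d: "d \<noteq> 0" "\<And>xs. xs \<in> ?t \<Longrightarrow> \<phi> (xs @ bs) = d * \<phi> (xs @ as)"
      using minor_proportional[OF F \<phi> lm ext as(1) tr \<theta>(3,4)] by blast
    note lb = basis_traces_list[OF F \<phi> lm ext \<theta>(3,4)]
    \<comment> \<open>\<open>c\<close> accounts for the change of representative, \<open>d\<close>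
      for the change of added elements.\<close>
    have "\<theta> = restrict (\<lambda>xs. (c * d) * \<rho> xs) ?t"
      unfolding \<theta>(1)
    proof (rule restrict_ext)
      fix xs assume xs: "xs \<in> ?t"
      then have "xs @ bs \<in> tuples (ground M) (mrank M)"
        using append_in_tuples[OF F \<phi> lm ext] lb by auto
      then show "\<psi> (xs @ bs) = (c * d) * \<rho> xs" using c d xs by (simp add: \<rho>_def mult.assoc)
    qed
    moreover have "c * d \<noteq> 0" using c d by simp
    ultimately show "\<theta> \<in> unit_class ?T m \<rho>" by (auto simp: unit_class_def)
  next
    fix \<theta> assume "\<theta> \<in> unit_class ?T m \<rho>"
    then obtain c where c: "c \<noteq> 0" "\<theta> = restrict (\<lambda>xs. c * \<rho> xs) ?t" by (auto simp: unit_class_def)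
    let ?\<psi> = "restrict (\<lambda>xs. c * \<phi> xs) (tuples (ground M) (mrank M))"
    have "\<theta> = restrict (\<lambda>xs. ?\<psi> (xs @ as)) ?t"
      unfolding c(2) by (rule restrict_ext) (simp add: \<rho>_def app)
    moreover have "?\<psi> \<in> reps M" using F_matroid_reps_scale[OF F \<phi> c(1)] .
    ultimately show "\<theta> \<in> ?R" using as(1) tr by blast
  qed
  ultimately show ?thesis using F by (auto simp: F_matroid_def)
qed

section \<open>Contraction and deletion as F-matroids\<close>

lemma rank_of_le:
  assumes "F_matroid NF M"
  shows "rank_of (bases M) A \<le> mrank M"
  using rank_of_attained(1)[OF assms, of A] bases_ground[OF assms]
  by (metis Int_lower1 card_mono)

text \<open>The rank of \<open>A\<close> is the largest trace size on \<open>A\<close>, hence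
  extreme, and the maximal independent subsets of \<open>A\<close> are the traces of that
  size.\<close>

lemma F_matroid_contract:
  assumes F: "F_matroid NF M"
  shows "F_matroid NF (contract M A)"
proof -
  let ?l = "rank_of (bases M) A"
  have "basis_traces (bases M) A ?l = {I. max_indep (bases M) A I}"
    by (auto simp: max_indep_iff[OF F] basis_traces_def)
  moreover have "extreme_trace_size (bases M) A ?l"
    using rank_of_attained(2)[OF F] by (simp add: extreme_trace_size_def)
  ultimately show ?thesis
    using minor_F_matroid[OF F, of "mrank M - ?l" ?l A] rank_of_le[OF F] rank_of_attained(1)[OF F]
    by (simp add: contract_def Let_def)
qed

lemma basis_card_split:
  assumes F: "F_matroid NF M" and B: "B \<in> bases M"
  shows "card (B \<inter> A) + card (B \<inter> (ground M - A)) = mrank M"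
proof -
  note g = bases_ground[OF F B]
  have "B = (B \<inter> A) \<union> (B \<inter> (ground M - A))" using g by auto
  moreover have "card ((B \<inter> A) \<union> (B \<inter> (ground M - A))) = card (B \<inter> A) + card (B \<inter> (ground M - A))"
    using g by (intro card_Un_disjoint) auto
  ultimately show ?thesis using g by simp
qed

text \<open>The size of a basis splits between \<open>A\<close> and its complement, so a trace of
  full rank on the complement corresponds to a trace of the complementary size on
  \<open>A\<close>.\<close>

lemma contraction_bases_eq_traces:
  assumes F: "F_matroid NF M"
  shows "contraction_bases (bases M) (ground M - A) =
    basis_traces (bases M) A (mrank M - rank_of (bases M) (ground M - A))"
proof (intro equalityI subsetI)
  let ?T = "ground M - A"
  fix C assume "C \<in> contraction_bases (bases M) ?T"
  then obtain I where I: "C \<inter> ?T = {}" "max_indep (bases M) ?T I" "C \<union> I \<in> bases M"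
    by (auto simp: contraction_bases_def)
  then have c: "card I = rank_of (bases M) ?T" "I \<subseteq> ?T"
    using max_indep_iff[OF F] by auto
  \<comment> \<open>\<open>C\<close> avoids the complement of \<open>A\<close> and lies in a basis,
    so it is contained in \<open>A\<close>.\<close>
  have "(C \<union> I) \<inter> A = C" "(C \<union> I) \<inter> ?T = I" using I c bases_ground[OF F I(3)] by auto
  moreover from this have "card C = mrank M - rank_of (bases M) ?T"
    using basis_card_split[OF F I(3), of A] c by simp
  ultimately show "C \<in> basis_traces (bases M) A (mrank M - rank_of (bases M) ?T)"
    using I(3) by (intro basis_tracesI)
next
  let ?T = "ground M - A"
  fix C assume "C \<in> basis_traces (bases M) A (mrank M - rank_of (bases M) ?T)"
  then obtain B where B: "B \<in> bases M" "B \<inter> A = C" "card C = mrank M - rank_of (bases M) ?T"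
    by (auto simp: basis_traces_def)
  have "card (B \<inter> ?T) = rank_of (bases M) ?T"
    using basis_card_split[OF F B(1), of A] B rank_of_le[OF F, of ?T] by simp
  then have "max_indep (bases M) ?T (B \<inter> ?T)" using B(1) max_indep_iff[OF F] by blast
  moreover have "C \<union> (B \<inter> ?T) = B" using B bases_ground[OF F B(1)] by auto
  ultimately show "C \<in> contraction_bases (bases M) ?T"
    using B unfolding contraction_bases_def by auto
qed

text \<open>A basis that meets the complement in as many elements as possible meets \<open>A\<close>
  in as few as possible, so the trace size is extreme from below.\<close>

lemma F_matroid_delete:
  assumes F: "F_matroid NF M"
  shows "F_matroid NF (delete M A)"
proof -
  let ?m = "rank_of (bases M) (ground M - A)"
  have sum: "?m + (mrank M - ?m) = mrank M" using rank_of_le[OF F] by simp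
  have "mrank M - ?m \<le> card (B \<inter> A)" if "B \<in> bases M" for B
    using basis_card_split[OF F that, of A] rank_of_attained(2)[OF F that, of "ground M - A"] by simp
  then have ext: "extreme_trace_size (bases M) A (mrank M - ?m)" by (simp add: extreme_trace_size_def)
  obtain B where B: "B \<in> bases M" "card (B \<inter> (ground M - A)) = ?m"
    using rank_of_attained(1)[OF F] by blast
  then have "card (B \<inter> A) = mrank M - ?m" using basis_card_split[OF F B(1), of A] by simp
  then show ?thesis
    using minor_F_matroid[OF F sum ext] B(1)
    by (auto simp: delete_def Let_def contraction_bases_eq_traces[OF F])
qed

section \<open>Quotients between two minors\<close>

text \<open>Both minor constructions are unfolded down to a representative of \<open>M\<close>. The
  facts on lengths and on vanishing values are those that remove the extra terms in the quotient
  relation.\<close>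

lemma contract_delete_rep:
  assumes F: "F_matroid NF M" and \<mu>: "\<mu> \<in> reps (contract (delete M I) J)"
  defines "T \<equiv> ground M - I - J" and "m \<equiv> mrank (contract (delete M I) J)"
  obtains \<phi> as bs where "\<phi> \<in> reps M" "\<mu> = restrict (\<lambda>xs. \<phi> (xs @ as @ bs)) (tuples T m)"
    "set as \<subseteq> J \<inter> (ground M - I)" "set bs \<subseteq> ground M"
    "m + length as = rank_of (bases M) (ground M - I)" "m + length (as @ bs) = mrank M"
    "\<And>y xs. y \<in> J \<inter> (ground M - I) \<Longrightarrow> 0 < m \<Longrightarrow> xs \<in> tuples T (m - 1) \<Longrightarrow> \<phi> (y # xs @ as @ bs) = 0"
proof -
  let ?D = "delete M I" and ?k = "rank_of (bases M) (ground M - I)"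
  have D: "F_matroid NF ?D" using F by (rule F_matroid_delete)
  have gD: "ground ?D = ground M - I" "mrank ?D = ?k" by (simp_all add: delete_def Let_def)
  have m: "m = ?k - rank_of (bases ?D) J" by (simp add: m_def contract_def Let_def gD)
  obtain \<phi>' as where as: "\<mu> = restrict (\<lambda>xs. \<phi>' (xs @ as)) (tuples T m)" "\<phi>' \<in> reps ?D"
    "distinct as" "max_indep (bases ?D) J (set as)"
    using \<mu> by (auto simp: contract_def Let_def gD m T_def)
  obtain \<phi> bs where bs: "\<phi>' = restrict (\<lambda>xs. \<phi> (xs @ bs)) (tuples (ground M - I) ?k)"
    "\<phi> \<in> reps M" "distinct bs" "set bs \<in> contraction_bases (bases M) (ground M - I)"
    using as(2) by (auto simp: delete_def Let_def)
  obtain B where B: "B \<in> bases ?D" "B \<inter> J = set as" "card (set as) = rank_of (bases ?D) J"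
    using as(4) max_indep_iff[OF D] by blast
  have sa: "set as \<subseteq> J \<inter> (ground M - I)" using bases_ground(1)[OF D B(1)] B(2) gD by auto
  have la: "m + length as = ?k"
    using m B(3) as(3) rank_of_le[OF D, of J] gD by (simp add: distinct_card)
  obtain B' where B': "B' \<in> bases M" "B' \<inter> I = set bs" "card (set bs) = mrank M - ?k"
    using bs(4) unfolding contraction_bases_eq_traces[OF F] by (auto simp: basis_traces_def)
  have lb: "?k + length bs = mrank M"
    using B'(3) bs(3) rank_of_le[OF F, of "ground M - I"] by (simp add: distinct_card)
  have sb: "set bs \<subseteq> ground M" using B' bases_ground(1)[OF F] by auto
  show thesis
  proof (rule that[OF bs(2) _ sa sb la])
    show "\<mu> = restrict (\<lambda>xs. \<phi> (xs @ as @ bs)) (tuples T m)"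
      unfolding as(1)
    proof (rule restrict_ext)
      fix xs assume "xs \<in> tuples T m"
      then have "xs @ as \<in> tuples (ground M - I) ?k"
        using sa la by (auto simp: tuples_def T_def)
      then show "\<phi>' (xs @ as) = \<phi> (xs @ as @ bs)" by (simp add: bs(1))
    qed
    show "m + length (as @ bs) = mrank M" using la lb by simp
    fix y xs assume y: "y \<in> J \<inter> (ground M - I)" and "0 < m" and "xs \<in> tuples T (m - 1)"
    then have t: "y # xs @ as \<in> tuples (ground ?D) (mrank ?D)"
      using sa la gD by (auto simp: tuples_def T_def)
    have "\<phi>' (y # xs @ as) = 0"
    proof (rule ccontr)
      assume "\<phi>' (y # xs @ as) \<noteq> 0"
      then have nz: "distinct (y # xs @ as)" "set (y # xs @ as) \<in> bases ?D"
        using reps_nonzero_iff[OF D as(2) t] by auto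
      then have "indep (bases ?D) (insert y (set as))" unfolding indep_def by (rule_tac bexI) auto
      \<comment> \<open>Maximality in \<open>J\<close> yields that \<open>y\<close> already occurs
        in \<open>as\<close>, which contradicts distinctness.\<close>
      then have "insert y (set as) = set as"
        using as(4) y unfolding max_indep_def by blast
      then show False using nz by auto
    qed
    then show "\<phi> (y # xs @ as @ bs) = 0" using t by (simp add: bs(1) gD)
  qed
qed

text \<open>The suffix 2 belongs to the source of the quotient and 1 to its target. An extra term
  moves an entry of \<open>as @ bs\<close>: one from \<open>as\<close> makes the factor of the
  target vanish, one from \<open>bs\<close> that of the source.\<close>

lemma contract_delete_quotient:
  assumes F: "F_matroid NF M" and J: "J2 \<subseteq> J1" "J1 \<inter> I1 = {}"
    and T: "ground M - I2 - J2 = ground M - I1 - J1"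
  shows "quotient NF (contract (delete M I2) J2) (contract (delete M I1) J1)"
  unfolding quotient_def
proof (intro conjI ballI)
  have g: "ground (contract (delete M I) J) = ground M - I - J" for I J
    by (simp add: contract_def delete_def Let_def)
  show "ground (contract (delete M I2) J2) = ground (contract (delete M I1) J1)"
    using T by (simp add: g)
  fix \<nu> \<mu>
  assume \<nu>: "\<nu> \<in> reps (contract (delete M I2) J2)" and \<mu>: "\<mu> \<in> reps (contract (delete M I1) J1)"
  define T w v where "T = ground M - I1 - J1"
    and "w = mrank (contract (delete M I2) J2)" and "v = mrank (contract (delete M I1) J1)"
  obtain \<phi> as bs where 2: "\<phi> \<in> reps M" "\<nu> = restrict (\<lambda>xs. \<phi> (xs @ as @ bs)) (tuples T w)"
    "set as \<subseteq> J2 \<inter> (ground M - I2)" "set bs \<subseteq> ground M"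
    "w + length as = rank_of (bases M) (ground M - I2)" "w + length (as @ bs) = mrank M"
    using contract_delete_rep[OF F \<nu>] unfolding T w_def T_def by metis
  obtain \<psi> cs ds where 1: "\<psi> \<in> reps M" "\<mu> = restrict (\<lambda>xs. \<psi> (xs @ cs @ ds)) (tuples T v)"
    "set cs \<subseteq> J1 \<inter> (ground M - I1)" "set ds \<subseteq> ground M" "v + length (cs @ ds) = mrank M"
    "\<And>y xs. y \<in> J1 \<inter> (ground M - I1) \<Longrightarrow> 0 < v \<Longrightarrow> xs \<in> tuples T (v - 1) \<Longrightarrow>
      \<psi> (y # xs @ cs @ ds) = 0"
    using contract_delete_rep[OF F \<mu>] unfolding v_def T_def by metis
  have "pluecker_relations NF T w \<nu> v \<mu>"
    unfolding 1(2) 2(2)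
  proof (rule pluecker_relations_append[OF F_matroid_reps_pluecker[OF F 2(1) 1(1)]])
    fix us y vs ys xs
    assume split: "as @ bs = us @ y # vs" and v: "0 < v" and ys: "ys \<in> tuples T (w + 1)"
      and xs: "xs \<in> tuples T (v - 1)"
    show "\<phi> (ys @ us @ vs) = 0 \<or> \<psi> (y # xs @ cs @ ds) = 0"
    proof (cases "length us < length as")
      case True
      then have "y = as ! length us" using split by (metis nth_append nth_append_length)
      then have "y \<in> set as" using True by simp
      then have "y \<in> J1 \<inter> (ground M - I1)" using 2(3) J by auto
      then show ?thesis using 1(6) v xs by blast
    next
      case False
      \<comment> \<open>The moved entry lies in \<open>bs\<close>, so all of \<open>as\<close>
        precedes it and survives.\<close>
      then have "as = take (length as) us" using split
        by (metis append_eq_append_conv_if append_take_drop_id not_less append_eq_conv_conj)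
      then obtain us' where us': "us = as @ us'" by (metis append_take_drop_id)
      have "set (us @ y # vs) \<subseteq> ground M" using 2(3,4) unfolding split[symmetric] by auto
      moreover have "w + length (us @ y # vs) = mrank M" using 2(6) unfolding split .
      ultimately have t: "ys @ us @ vs \<in> tuples (ground M) (mrank M)"
        using ys by (auto simp: tuples_def T_def)
      have "\<phi> (ys @ us @ vs) = 0"
      proof (rule ccontr)
        assume "\<phi> (ys @ us @ vs) \<noteq> 0"
        then have nz: "distinct (ys @ us @ vs)" "set (ys @ us @ vs) \<in> bases M"
          using reps_nonzero_iff[OF F 2(1) t] by auto
        \<comment> \<open>The \<open>w + 1\<close> entries of \<open>ys\<close> together with
          \<open>as\<close> form an independent set outside \<open>I2\<close> with one element more
          than the rank allows.\<close>
        have "set (ys @ as) \<subseteq> ground M - I2"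
          using ys 2(3) T by (auto simp: tuples_def T_def)
        moreover have "indep (bases M) (set (ys @ as))"
          using nz(2) unfolding indep_def by (rule bexI[rotated]) (auto simp: us')
        ultimately have "card (set (ys @ as)) \<le> rank_of (bases M) (ground M - I2)"
          by (intro rank_of_attained(3)[OF F])
        moreover have "card (set (ys @ as)) = length (ys @ as)"
          using nz(1) by (intro distinct_card) (auto simp: us')
        ultimately show False using 2(5) ys by (simp add: tuples_def)
      qed
      then show ?thesis by simp
    qed
  qed (use 1 2 in \<open>auto simp: T_def\<close>)
  then show "pluecker_relations NF (ground (contract (delete M I1) J1))
      (mrank (contract (delete M I2) J2)) \<nu> (mrank (contract (delete M I1) J1)) \<mu>"
    by (simp add: g T_def w_def v_def)
qed

end

theorem theorem2p21:
  fixes NF :: "'f::{comm_monoid_mult, mult_zero, zero_neq_one} multiset set"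
    and M' :: "(nat, 'f) fmat"
    and n p s :: nat
    and ns :: "nat \<Rightarrow> nat"
    and I J :: "nat \<Rightarrow> nat set"
    and M :: "nat \<Rightarrow> (nat, 'f) fmat"
  assumes "tract NF"
    and "F_matroid NF M'"
    and "ground M' = {1..n} \<union> {n + 1..n + p}"
    and "\<And>i j. 1 \<le> i \<Longrightarrow> i \<le> j \<Longrightarrow> j \<le> s \<Longrightarrow> ns j \<le> ns i"
    and "\<And>i. 1 \<le> i \<Longrightarrow> i \<le> s \<Longrightarrow> ns i \<le> p"
    and "\<And>i. 1 \<le> i \<Longrightarrow> i \<le> s \<Longrightarrow> J i = {n + 1..n + ns i}"
    and "\<And>i. 1 \<le> i \<Longrightarrow> i \<le> s \<Longrightarrow> I i = {n + ns i + 1..n + p}"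
    and "\<And>i. 1 \<le> i \<Longrightarrow> i \<le> s \<Longrightarrow> M i = contract (delete M' (I i)) (J i)"
  shows "flag_F_matroid NF {1..n} s M"
proof -
  interpret tract NF by fact
  \<comment> \<open>The intervals \<open>I i\<close> and \<open>J i\<close> cover all added
    elements, so the minors share one ground set.\<close>
  have g: "ground M' - I i - J i = {1..n}" if "1 \<le> i" "i \<le> s" for i
    using assms(5)[OF that] by (auto simp: assms(3) assms(6,7)[OF that])
  show ?thesis
    unfolding flag_F_matroid_def
  proof (intro conjI ballI allI impI)
    fix i assume "i \<in> {1..s}"
    then have i: "1 \<le> i" "i \<le> s" by auto
    show "F_matroid NF (M i)"
      unfolding assms(8)[OF i] by (intro F_matroid_contract F_matroid_delete assms(2))
    show "ground (M i) = {1..n}"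
      using g[OF i] by (simp add: assms(8)[OF i] contract_def delete_def Let_def)
  next
    fix i j assume "1 \<le> i \<and> i < j \<and> j \<le> s"
    then have i: "1 \<le> i" "i \<le> s" and j: "1 \<le> j" "j \<le> s" and ij: "i \<le> j" by auto
    show "quotient NF (M j) (M i)"
      unfolding assms(8)[OF i] assms(8)[OF j]
    \<comment> \<open>Since \<open>ns\<close> is weakly decreasing, the later minor contracts a
      subset of what the earlier one contracts, and so takes the suffix 2.\<close>
    proof (rule contract_delete_quotient[OF assms(2)])
      show "J j \<subseteq> J i" using assms(4)[OF i(1) ij j(2)] by (auto simp: assms(6)[OF i] assms(6)[OF j])
      show "J i \<inter> I i = {}" by (auto simp: assms(6,7)[OF i])
      show "ground M' - I j - J j = ground M' - I i - J i" using g[OF i] g[OF j] by simp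
    qed
  qed
qed

end
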